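(* Let $p$ be a prime and let $K$ be a $p$-adic path set fractal. Then the following are equivalent: (1) $K$ has Hausdorff dimension $1$; (2) the minimal deterministic finite automaton describing the $p$-adic expansions of the elements of $K$ has a state $q$ such that there is a transition $q\to q$ labelled $i$ for every $i=0,1,\dots,p-1$; (3) there exists a finite word $w$ over $\{0,\dots,p-1\}$ such that the language of $p$-adic expansions of elements of $K$ contains $w\{0,1,\dots,p-1\}^{\mathbb{N}}$.
   Context: A $p$-adic path set fractal is defined as follows: take a finite directed graph with a distinguished initial vertex, each edge labelled by a digit in $\{0,\dots,p-1\}$; the set consists of all $p$-adic integers $\sum_{i\ge0}c_ip^i$ ($c_i\in\{0,\dots,p-1\}$) such that $c_0c_1c_2\dots$ is the label sequence of an infinite path starting at the initial vertex. The language of $p$-adic expansions of $K$ is the set of such digit sequences $c_0c_1c_2\dots$; it is recognized by a deterministic finite automaton (all states accepting; an infinite word is accepted if it labels an infinite path from the initial state), and the minimal such automaton is unique up to isomorphism. Hausdorff dimension is with respect to the $p$-adic metric $|x-y|_p$. *)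

theory Defs
  imports
    "HOL-Analysis.Analysis"
    "HOL-Library.Omega_Words_Fun"
    "HOL-Number_Theory.Number_Theory"
    "Graph_Theory.Digraph"
begin

section \<open>The p-adic integers\<close>

text \<open>
  The ring of p-adic integers is the inverse limit of the rings of integers modulo \<open>p ^ n\<close>:
  a p-adic integer \<open>x\<close> is the coherent sequence of its residues, \<open>x n\<close> being the representative
  in \<open>{0..<p ^ n}\<close> of its class modulo \<open>p ^ n\<close>.
\<close>

definition padic_int :: "nat \<Rightarrow> (nat \<Rightarrow> int) set" where
  "padic_int p = {x. \<forall>n. 0 \<le> x n \<and> x n < int p ^ n \<and> x (Suc n) mod int p ^ n = x n}"

definition padic_of_int :: "nat \<Rightarrow> int \<Rightarrow> nat \<Rightarrow> int" where
  "padic_of_int p a = (\<lambda>n. a mod int p ^ n)"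

definition padic_diff :: "nat \<Rightarrow> (nat \<Rightarrow> int) \<Rightarrow> (nat \<Rightarrow> int) \<Rightarrow> nat \<Rightarrow> int" where
  "padic_diff p x y = (\<lambda>n. (x n - y n) mod int p ^ n)"

text \<open>The p-adic valuation of \<open>x \<noteq> 0\<close> is the largest \<open>n\<close> such that \<open>x n = 0\<close>.\<close>

definition padic_val :: "(nat \<Rightarrow> int) \<Rightarrow> nat" where
  "padic_val x = (LEAST n. x (Suc n) \<noteq> 0)"

definition padic_norm :: "nat \<Rightarrow> (nat \<Rightarrow> int) \<Rightarrow> real" where
  "padic_norm p x = (if x = (\<lambda>_. 0) then 0 else (1 / real p) ^ padic_val x)"

definition padic_dist :: "nat \<Rightarrow> (nat \<Rightarrow> int) \<Rightarrow> (nat \<Rightarrow> int) \<Rightarrow> real" where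
  "padic_dist p x y = padic_norm p (padic_diff p x y)"

definition digit_seqs :: "nat \<Rightarrow> nat word set" where
  "digit_seqs p = {c. \<forall>i. c i < p}"

text \<open>
  The p-adic integer \<open>\<Sum>i. c i * p ^ i\<close>: modulo \<open>p ^ n\<close>, only the terms with \<open>i < n\<close> survive.
  That it is the p-adic limit of the partial sums is \<open>padic_of_digits_limit\<close> below.
\<close>

definition padic_of_digits :: "nat \<Rightarrow> nat word \<Rightarrow> nat \<Rightarrow> int" where
  "padic_of_digits p c = (\<lambda>n. (\<Sum>i<n. int (c i) * int p ^ i) mod int p ^ n)"

definition padic_language :: "nat \<Rightarrow> (nat \<Rightarrow> int) set \<Rightarrow> nat word set" where
  "padic_language p K = {c \<in> digit_seqs p. padic_of_digits p c \<in> K}"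

section \<open>Hausdorff dimension\<close>

text \<open>
  Diameters are extended nonnegative reals, and the empty set has diameter 0.
  Only exponents \<open>s > 0\<close> are used. This avoids the conventions needed for \<open>0 ^ 0\<close> when
  \<open>s = 0\<close>, and it does not change the infimum that defines the dimension.
\<close>

definition ediam :: "('a \<Rightarrow> 'a \<Rightarrow> real) \<Rightarrow> 'a set \<Rightarrow> ennreal" where
  "ediam d U = (SUP x\<in>U. SUP y\<in>U. ennreal (d x y))"

definition hausdorff_content ::
    "'a set \<Rightarrow> ('a \<Rightarrow> 'a \<Rightarrow> real) \<Rightarrow> real \<Rightarrow> real \<Rightarrow> 'a set \<Rightarrow> ennreal" where
  "hausdorff_content M d s \<delta> E =
     Inf {(\<Sum>i. ennreal (enn2real (ediam d (U i)) powr s)) | U :: nat \<Rightarrow> 'a set.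
            (\<forall>i. U i \<subseteq> M \<and> ediam d (U i) \<le> ennreal \<delta>) \<and> E \<subseteq> (\<Union>i. U i)}"

definition hausdorff_measure ::
    "'a set \<Rightarrow> ('a \<Rightarrow> 'a \<Rightarrow> real) \<Rightarrow> real \<Rightarrow> 'a set \<Rightarrow> ennreal" where
  "hausdorff_measure M d s E = (SUP \<delta>\<in>{0<..}. hausdorff_content M d s \<delta> E)"

definition hausdorff_dim :: "'a set \<Rightarrow> ('a \<Rightarrow> 'a \<Rightarrow> real) \<Rightarrow> 'a set \<Rightarrow> ennreal" where
  "hausdorff_dim M d E = Inf {ennreal s | s. s > 0 \<and> hausdorff_measure M d s E = 0}"

section \<open>Path set fractals\<close>

locale path_presentation = fin_digraph G for G :: "('v, 'e) pre_digraph" (structure) +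
  fixes p :: nat and lab :: "'e \<Rightarrow> nat" and v0 :: 'v
  assumes initial_vertex: "v0 \<in> verts G"
    and label_digit: "e \<in> arcs G \<Longrightarrow> lab e < p"

definition path_labels :: "('v, 'e) pre_digraph \<Rightarrow> ('e \<Rightarrow> nat) \<Rightarrow> 'v \<Rightarrow> nat word set" where
  "path_labels G lab v0 = {lab \<circ> e | e :: 'e word.
     (\<forall>i. e i \<in> arcs G) \<and> tail G (e 0) = v0 \<and> (\<forall>i. head G (e i) = tail G (e (Suc i)))}"

definition path_set_fractal ::
    "nat \<Rightarrow> ('v, 'e) pre_digraph \<Rightarrow> ('e \<Rightarrow> nat) \<Rightarrow> 'v \<Rightarrow> (nat \<Rightarrow> int) set" where
  "path_set_fractal p G lab v0 = padic_of_digits p ` path_labels G lab v0"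

section \<open>Deterministic finite automata on infinite words\<close>

text \<open>
  The transition function is partial: as all states are accepting, a word is rejected only
  because a transition is missing.
\<close>

record 'q dfa =
  states :: "'q set"
  start :: 'q
  delta :: "'q \<Rightarrow> nat \<Rightarrow> 'q option"

definition is_dfa :: "nat \<Rightarrow> 'q dfa \<Rightarrow> bool" where
  "is_dfa p M \<longleftrightarrow> finite (states M) \<and> start M \<in> states M \<and>
     (\<forall>q\<in>states M. \<forall>i<p. \<forall>q'. delta M q i = Some q' \<longrightarrow> q' \<in> states M)"

definition dfa_language :: "nat \<Rightarrow> 'q dfa \<Rightarrow> nat word set" where
  "dfa_language p M = {c \<in> digit_seqs p.
     \<exists>r. r 0 = start M \<and> (\<forall>n. delta M (r n) (c n) = Some (r (Suc n)))}"

definition recognizes :: "nat \<Rightarrow> 'q dfa \<Rightarrow> nat word set \<Rightarrow> bool" where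
  "recognizes p M L \<longleftrightarrow> is_dfa p M \<and> dfa_language p M = L"

text \<open>
  Minimal means having the least number of states. The automata in competition have natural
  numbers as states, which is no restriction (\<open>recognizes_nat\<close> below) and makes minimality
  independent of the state type of \<open>M\<close>.
\<close>

definition minimal_dfa :: "nat \<Rightarrow> nat word set \<Rightarrow> 'q dfa \<Rightarrow> bool" where
  "minimal_dfa p L M \<longleftrightarrow> recognizes p M L \<and>
     (\<forall>N :: nat dfa. recognizes p N L \<longrightarrow> card (states M) \<le> card (states N))"

section \<open>Adequacy of the definitions\<close>

lemma padic_norm_le:
  assumes "p > 1" "\<And>m. m \<le> n \<Longrightarrow> x m = 0"
  shows "padic_norm p x \<le> (1 / real p) ^ n"
proof (cases "x = (\<lambda>_. 0)")
  case False
  then obtain m where m: "x m \<noteq> 0" by auto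
  with assms(2)[of 0] obtain k where "m = Suc k" by (cases m) auto
  with m have "x (Suc (padic_val x)) \<noteq> 0" unfolding padic_val_def by (metis (mono_tags) LeastI)
  with assms(2)[of "Suc (padic_val x)"] have "n \<le> padic_val x" by linarith
  then show ?thesis using False assms(1) by (simp add: padic_norm_def power_decreasing)
qed (simp add: padic_norm_def)

lemma padic_int_mod:
  assumes "x \<in> padic_int p" "m \<le> n"
  shows "x n mod int p ^ m = x m"
  using assms(2)
proof (induction rule: dec_induct)
  case base
  then show ?case using assms(1) by (simp add: padic_int_def)
next
  case (step n)
  have "x (Suc n) mod int p ^ m = (x (Suc n) mod int p ^ n) mod int p ^ m"
    using step by (simp add: le_imp_power_dvd mod_mod_cancel)
  then show ?case using step assms(1) by (simp add: padic_int_def)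
qed

lemma padic_diff_coherent:
  assumes "x \<in> padic_int p" "y \<in> padic_int p" "m \<le> n" "padic_diff p x y n = 0"
  shows "padic_diff p x y m = 0"
proof -
  have "int p ^ m dvd x n - y n"
    using assms(3,4) by (auto simp: padic_diff_def intro: dvd_trans[OF le_imp_power_dvd])
  then have "x n mod int p ^ m = y n mod int p ^ m" by (simp add: mod_eq_dvd_iff)
  then show ?thesis using assms by (simp add: padic_diff_def padic_int_mod)
qed

lemma padic_diff_val:
  assumes "x \<in> padic_int p" "y \<in> padic_int p" "padic_diff p x y \<noteq> (\<lambda>_. 0)"
  shows "m \<le> padic_val (padic_diff p x y) \<longleftrightarrow> padic_diff p x y m = 0"
proof -
  let ?z = "padic_diff p x y"
  have z0: "?z 0 = 0" by (simp add: padic_diff_def)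
  obtain k where "?z k \<noteq> 0" using assms(3) by auto
  with z0 obtain j where "?z (Suc j) \<noteq> 0" by (cases k) auto
  then have A: "?z (Suc (padic_val ?z)) \<noteq> 0" unfolding padic_val_def by (rule LeastI)
  have B: "?z m = 0" if "m \<le> padic_val ?z"
  proof (cases m)
    case (Suc i)
    with that have "i < (LEAST n. ?z (Suc n) \<noteq> 0)" by (simp add: padic_val_def)
    from not_less_Least[OF this] Suc show ?thesis by simp
  qed (use z0 in simp)
  show ?thesis using A B padic_diff_coherent[OF assms(1,2), of "Suc (padic_val ?z)" m] by fastforce
qed

lemma Metric_space_padic:
  assumes "p > 1"
  shows "Metric_space (padic_int p) (padic_dist p)"
proof
  fix x y
  show "0 \<le> padic_dist p x y" by (simp add: padic_dist_def padic_norm_def)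
  have "padic_diff p x y n = 0 \<longleftrightarrow> padic_diff p y x n = 0" for n
    unfolding padic_diff_def dvd_eq_mod_eq_0[symmetric] by (rule dvd_diff_commute)
  then have "padic_val (padic_diff p x y) = padic_val (padic_diff p y x)"
    "padic_diff p x y = (\<lambda>_. 0) \<longleftrightarrow> padic_diff p y x = (\<lambda>_. 0)"
    by (auto simp: padic_val_def fun_eq_iff)
  then show "padic_dist p x y = padic_dist p y x" by (simp add: padic_dist_def padic_norm_def)
next
  fix x y assume xy: "x \<in> padic_int p" "y \<in> padic_int p"
  have "x n = y n" if "padic_diff p x y n = 0" for n
  proof -
    from that have "x n mod int p ^ n = y n mod int p ^ n"
      by (simp add: padic_diff_def mod_eq_dvd_iff mod_0_imp_dvd)
    with xy show ?thesis by (simp add: padic_int_mod)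
  qed
  then have "padic_diff p x y = (\<lambda>_. 0) \<longleftrightarrow> x = y"
    by (auto simp: fun_eq_iff padic_diff_def)
  then show "padic_dist p x y = 0 \<longleftrightarrow> x = y"
    using assms by (auto simp: padic_dist_def padic_norm_def)
next
  fix x y z assume xyz: "x \<in> padic_int p" "y \<in> padic_int p" "z \<in> padic_int p"
  show "padic_dist p x z \<le> padic_dist p x y + padic_dist p y z"
  proof (rule ccontr)
    assume neg: "\<not> ?thesis"
    have nn: "0 \<le> padic_dist p a b" for a b by (simp add: padic_dist_def padic_norm_def)
    have xz: "padic_diff p x z \<noteq> (\<lambda>_. 0)"
    proof
      assume "padic_diff p x z = (\<lambda>_. 0)"
      then have "padic_dist p x z = 0" by (simp add: padic_dist_def padic_norm_def)
      with neg nn[of x y] nn[of y z] show False by linarith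
    qed
    define v where "v = padic_val (padic_diff p x z)"
    have d: "padic_dist p x z = (1 / real p) ^ v" using xz by (simp add: padic_dist_def padic_norm_def v_def)
    have key: "padic_diff p a b (Suc v) = 0"
      if ab: "a \<in> padic_int p" "b \<in> padic_int p" "padic_dist p a b < padic_dist p x z" for a b
    proof (cases "padic_diff p a b = (\<lambda>_. 0)")
      case False
      then have "(1 / real p) ^ padic_val (padic_diff p a b) < (1 / real p) ^ v"
        using ab d by (simp add: padic_dist_def padic_norm_def)
      then have "v < padic_val (padic_diff p a b)"
        using assms by (subst (asm) power_strict_decreasing_iff) auto
      then show ?thesis using padic_diff_val[OF ab(1,2) False, of "Suc v"] by simp
    qed simp
    have "padic_diff p x y (Suc v) = 0" "padic_diff p y z (Suc v) = 0"
      using key xyz neg nn[of x y] nn[of y z] by force+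
    then have "int p ^ Suc v dvd (x (Suc v) - y (Suc v)) + (y (Suc v) - z (Suc v))"
      unfolding padic_diff_def by (intro dvd_add) (auto simp only: dvd_eq_mod_eq_0)
    then have "padic_diff p x z (Suc v) = 0" by (simp add: padic_diff_def)
    then show False using padic_diff_val[OF xyz(1,3) xz, of "Suc v"] v_def by simp
  qed
qed

lemma digit_sum_mod:
  assumes "m \<le> n"
  shows "(\<Sum>i<n. int (c i) * int p ^ i) mod int p ^ m = padic_of_digits p c m"
  using assms
proof (induction rule: dec_induct)
  case (step n)
  have "int p ^ m dvd int (c n) * int p ^ n" using step by (simp add: le_imp_power_dvd dvd_mult)
  then have "((\<Sum>i<n. int (c i) * int p ^ i) + int (c n) * int p ^ n) mod int p ^ m
      = (\<Sum>i<n. int (c i) * int p ^ i) mod int p ^ m"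
    unfolding mod_eq_dvd_iff by simp
  then show ?case using step by simp
qed (simp add: padic_of_digits_def)

lemma padic_of_digits_in_padic_int:
  assumes "p > 0"
  shows "padic_of_digits p c \<in> padic_int p"
proof -
  have "padic_of_digits p c (Suc n) mod int p ^ n = padic_of_digits p c n" for n
  proof -
    have "padic_of_digits p c (Suc n) mod int p ^ n
        = (\<Sum>i<Suc n. int (c i) * int p ^ i) mod int p ^ n"
      unfolding padic_of_digits_def by (rule mod_mod_cancel) (simp add: le_imp_power_dvd)
    then show ?thesis using digit_sum_mod[of n "Suc n" c p] by simp
  qed
  then show ?thesis using assms by (auto simp: padic_int_def padic_of_digits_def)
qed

lemma padic_of_digits_limit:
  assumes "p > 1"
  shows "limitin (Metric_space.mtopology (padic_int p) (padic_dist p))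
           (\<lambda>n. padic_of_int p (\<Sum>i<n. int (c i) * int p ^ i)) (padic_of_digits p c) sequentially"
proof -
  interpret Metric_space "padic_int p" "padic_dist p" using assms by (rule Metric_space_padic)
  have le: "padic_dist p (padic_of_int p (\<Sum>i<n. int (c i) * int p ^ i)) (padic_of_digits p c)
      \<le> (1 / real p) ^ n" for n
    unfolding padic_dist_def using assms
    by (intro padic_norm_le) (simp_all add: padic_diff_def padic_of_int_def digit_sum_mod)
  have int: "padic_of_int p a \<in> padic_int p" for a
    using assms by (auto simp: padic_int_def padic_of_int_def intro!: mod_mod_cancel)
  have "(\<lambda>n. (1 / real p) ^ n) \<longlonglongrightarrow> 0" using assms by (intro LIMSEQ_power_zero) simp
  then have "\<forall>\<^sub>F n in sequentially. (1 / real p) ^ n < e" if "e > 0" for e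
    using that by (rule order_tendstoD)
  then have "\<forall>\<^sub>F n in sequentially.
      padic_dist p (padic_of_int p (\<Sum>i<n. int (c i) * int p ^ i)) (padic_of_digits p c) < e"
    if "e > 0" for e
    using that le by (fastforce elim: eventually_mono intro: le_less_trans)
  then show ?thesis
    using padic_of_digits_in_padic_int[of p c] assms int by (simp add: limitin_metric)
qed

lemma padic_of_digits_inj:
  assumes "p > 0"
  shows "inj_on (padic_of_digits p) (digit_seqs p)"
proof (rule inj_onI, rule ext)
  fix c d n assume c: "c \<in> digit_seqs p" and d: "d \<in> digit_seqs p"
    and eq: "padic_of_digits p c = padic_of_digits p d"
  have bound: "0 \<le> (\<Sum>i<n. int (c i) * int p ^ i) \<and> (\<Sum>i<n. int (c i) * int p ^ i) < int p ^ n"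
    if "c \<in> digit_seqs p" for c n
  proof (induction n)
    case (Suc n)
    have "c n < p" using that by (simp add: digit_seqs_def)
    then have "(int (c n) + 1) * int p ^ n \<le> int p * int p ^ n" by (intro mult_right_mono) auto
    with Suc show ?case by (simp add: distrib_right)
  qed simp
  have sums: "(\<Sum>i<n. int (c i) * int p ^ i) = (\<Sum>i<n. int (d i) * int p ^ i)" for n
    using fun_cong[OF eq, of n] bound[OF c, of n] bound[OF d, of n]
    by (simp add: padic_of_digits_def)
  show "c n = d n" using sums[of n] sums[of "Suc n"] assms by simp
qed

lemma (in path_presentation) padic_language_path_set_fractal:
  "padic_language p (path_set_fractal p G lab v0) = path_labels G lab v0"
proof -
  have sub: "path_labels G lab v0 \<subseteq> digit_seqs p"
    using label_digit by (auto simp: path_labels_def digit_seqs_def)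
  show ?thesis
  proof (cases "arcs G = {}")
    case True
    then show ?thesis
      by (auto simp: padic_language_def path_set_fractal_def path_labels_def)
  next
    case False
    then have "p > 0" using label_digit by fastforce
    from padic_of_digits_inj[OF this] sub show ?thesis
      by (auto simp: padic_language_def path_set_fractal_def dest: inj_onD)
  qed
qed

lemma recognizes_nat:
  fixes M :: "'q dfa"
  assumes "recognizes p M L"
  shows "\<exists>N :: nat dfa. recognizes p N L \<and> card (states N) = card (states M)"
proof -
  have fin: "finite (states M)" and st: "start M \<in> states M"
    and cl: "\<And>q i q'. q \<in> states M \<Longrightarrow> i < p \<Longrightarrow> delta M q i = Some q' \<Longrightarrow> q' \<in> states M"
    and L: "L = dfa_language p M"
    using assms by (auto simp: recognizes_def is_dfa_def)
  obtain f :: "'q \<Rightarrow> nat" where f: "inj_on f (states M)"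
    using finite_imp_inj_to_nat_seg[OF fin] by blast
  let ?g = "inv_into (states M) f"
  define N where "N = \<lparr>states = f ` states M, start = f (start M),
    delta = (\<lambda>n i. map_option f (delta M (?g n) i))\<rparr>"
  have "is_dfa p N"
    using fin st cl f by (auto simp: is_dfa_def N_def)
  moreover have "c \<in> dfa_language p M \<longleftrightarrow> c \<in> dfa_language p N" for c
  proof
    assume "c \<in> dfa_language p M"
    then obtain r where c: "c \<in> digit_seqs p" and r0: "r 0 = start M"
      and r: "\<And>n. delta M (r n) (c n) = Some (r (Suc n))"
      by (auto simp: dfa_language_def)
    have in_st: "r n \<in> states M" for n
    proof (induction n)
      case (Suc n)
      show ?case by (rule cl[OF Suc _ r]) (use c in \<open>simp add: digit_seqs_def\<close>)
    qed (simp add: r0 st)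
    have "delta N (f (r n)) (c n) = Some (f (r (Suc n)))" for n
      using in_st[of n] f r[of n] by (simp add: N_def)
    then show "c \<in> dfa_language p N"
      using c r0 unfolding dfa_language_def
      by (intro CollectI conjI exI[of _ "f \<circ> r"]) (auto simp: N_def)
  next
    assume "c \<in> dfa_language p N"
    then obtain s where c: "c \<in> digit_seqs p" and s0: "s 0 = f (start M)"
      and s: "\<And>n. delta N (s n) (c n) = Some (s (Suc n))"
      by (auto simp: dfa_language_def N_def)
    have in_st: "s n \<in> f ` states M" for n
    proof (induction n)
      case (Suc n)
      then obtain q where q: "q \<in> states M" "s n = f q" by auto
      with s[of n] f obtain q' where "delta M q (c n) = Some q'" "s (Suc n) = f q'"
        by (auto simp: N_def)
      then show ?case using cl[OF q(1)] c by (auto simp: digit_seqs_def)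
    qed (simp add: s0 st)
    have "delta M (?g (s n)) (c n) = Some (?g (s (Suc n)))" for n
    proof -
      obtain q where q: "delta M (?g (s n)) (c n) = Some q" "s (Suc n) = f q"
        using s[of n] by (auto simp: N_def)
      have "q \<in> states M"
        using cl[OF _ _ q(1)] in_st[of n] c by (auto simp: digit_seqs_def inv_into_into)
      then show ?thesis using q f by simp
    qed
    then show "c \<in> dfa_language p M"
      using c s0 st f unfolding dfa_language_def
      by (intro CollectI conjI exI[of _ "?g \<circ> s"]) auto
  qed
  ultimately have "recognizes p N L" using L by (auto simp: recognizes_def)
  moreover have "card (states N) = card (states M)" using f by (simp add: N_def card_image)
  ultimately show ?thesis by blast
qed

fun reads :: "('v, 'e) pre_digraph \<Rightarrow> ('e \<Rightarrow> nat) \<Rightarrow> nat word \<Rightarrow> nat \<Rightarrow> nat \<Rightarrow> 'v \<Rightarrow> bool" where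
  "reads G lab c 0 n v \<longleftrightarrow> True"
| "reads G lab c (Suc k) n v \<longleftrightarrow>
     (\<exists>e\<in>arcs G. tail G e = v \<and> lab e = c n \<and> reads G lab c k (Suc n) (head G e))"

lemma reads_mono: "reads G lab c l n v \<Longrightarrow> k \<le> l \<Longrightarrow> reads G lab c k n v"
proof (induction k arbitrary: l n v)
  case (Suc k)
  then obtain l' where "l = Suc l'" "k \<le> l'" by (cases l) auto
  with Suc show ?case by auto
qed simp

context path_presentation
begin

lemma reads_step:
  assumes "\<And>k. reads G lab c k n v"
  shows "\<exists>e\<in>arcs G. tail G e = v \<and> lab e = c n \<and> (\<forall>k. reads G lab c k (Suc n) (head G e))"
proof (rule ccontr)
  assume neg: "\<not> ?thesis"
  define A where "A = {e \<in> arcs G. tail G e = v \<and> lab e = c n}"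
  have "\<forall>e\<in>A. \<exists>k. \<not> reads G lab c k (Suc n) (head G e)" using neg by (auto simp: A_def)
  then obtain k where k: "\<And>e. e \<in> A \<Longrightarrow> \<not> reads G lab c (k e) (Suc n) (head G e)" by metis
  obtain e where e: "e \<in> A" "reads G lab c (Max (k ` A)) (Suc n) (head G e)"
    using assms[of "Suc (Max (k ` A))"] by (auto simp: A_def)
  have "k e \<le> Max (k ` A)" using e(1) by (intro Max_ge) (auto simp: A_def)
  from reads_mono[OF e(2) this] k[OF e(1)] show False by contradiction
qed

lemma path_labels_iff_reads: "c \<in> path_labels G lab v0 \<longleftrightarrow> (\<forall>k. reads G lab c k 0 v0)"
proof
  assume "c \<in> path_labels G lab v0"
  then obtain e where e: "\<And>i. e i \<in> arcs G" "tail G (e 0) = v0"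
    "\<And>i. head G (e i) = tail G (e (Suc i))" "c = lab \<circ> e"
    by (auto simp: path_labels_def)
  have "reads G lab c k n (tail G (e n))" for k n
    by (induction k arbitrary: n) (use e in auto)
  then show "\<forall>k. reads G lab c k 0 v0" using e(2) by metis
next
  assume R: "\<forall>k. reads G lab c k 0 v0"
  define P where "P n e \<longleftrightarrow> e \<in> arcs G \<and> lab e = c n \<and> (n = 0 \<longrightarrow> tail G e = v0) \<and>
    (\<forall>k. reads G lab c k (Suc n) (head G e))" for n e
  have "\<exists>e. \<forall>n. P n (e n) \<and> head G (e n) = tail G (e (Suc n))"
  proof (rule dependent_nat_choice)
    show "\<exists>e. P 0 e" using reads_step[of c 0 v0] R by (auto simp: P_def)
    show "\<exists>e'. P (Suc n) e' \<and> head G e = tail G e'" if "P n e" for e n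
      using reads_step[of c "Suc n" "head G e"] that by (auto simp: P_def)
  qed
  then obtain e where "\<And>n. P n (e n)" "\<And>n. head G (e n) = tail G (e (Suc n))" by blast
  then show "c \<in> path_labels G lab v0"
    unfolding path_labels_def by (auto simp: P_def fun_eq_iff intro!: exI[of _ e])
qed

definition succs :: "'v set \<Rightarrow> nat \<Rightarrow> 'v set" where
  "succs S i = {head G e | e. e \<in> arcs G \<and> tail G e \<in> S \<and> lab e = i}"

definition subset_dfa :: "'v set dfa" where
  "subset_dfa = \<lparr>states = Pow (verts G), start = {v0},
     delta = (\<lambda>S i. if succs S i = {} then None else Some (succs S i))\<rparr>"

lemma recognizes_subset_dfa: "recognizes p subset_dfa (path_labels G lab v0)"
proof -
  have "is_dfa p subset_dfa"
    using initial_vertex by (auto simp: is_dfa_def subset_dfa_def succs_def split: if_splits)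
  moreover have "c \<in> dfa_language p subset_dfa \<longleftrightarrow> c \<in> path_labels G lab v0" for c
  proof
    assume "c \<in> dfa_language p subset_dfa"
    then obtain r where r0: "r 0 = {v0}"
      and r: "\<And>n. delta subset_dfa (r n) (c n) = Some (r (Suc n))"
      by (auto simp: dfa_language_def subset_dfa_def)
    have r': "r (Suc n) = succs (r n) (c n)" "succs (r n) (c n) \<noteq> {}" for n
      using r[of n] by (auto simp: subset_dfa_def split: if_splits)
    have "\<exists>v\<in>r n. reads G lab c k n v" for k n
    proof (induction k arbitrary: n)
      case 0
      then show ?case by (cases n) (simp_all add: r0 r' ex_in_conv)
    next
      case (Suc k)
      from Suc[of "Suc n"] show ?case by (auto simp: r'(1) succs_def)
    qed
    from this[of 0] show "c \<in> path_labels G lab v0" by (auto simp: path_labels_iff_reads r0)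
  next
    assume "c \<in> path_labels G lab v0"
    then obtain e where e: "\<And>i. e i \<in> arcs G" "tail G (e 0) = v0"
      "\<And>i. head G (e i) = tail G (e (Suc i))" "c = lab \<circ> e"
      by (auto simp: path_labels_def)
    define r where "r = rec_nat {v0} (\<lambda>n S. succs S (c n))"
    have rS: "r 0 = {v0}" "r (Suc n) = succs (r n) (c n)" for n by (simp_all add: r_def)
    have mem: "tail G (e n) \<in> r n" for n
    proof (induction n)
      case (Suc n)
      have "head G (e n) \<in> succs (r n) (c n)"
        unfolding succs_def using Suc e(1,4) by (intro CollectI exI[of _ "e n"]) simp
      then show ?case by (simp add: rS e(3))
    qed (simp add: rS e(2))
    have "delta subset_dfa (r n) (c n) = Some (r (Suc n))" for n
      using mem[of "Suc n"] by (auto simp: subset_dfa_def rS)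
    moreover have "c \<in> digit_seqs p" using e label_digit by (auto simp: digit_seqs_def)
    ultimately show "c \<in> dfa_language p subset_dfa"
      unfolding dfa_language_def
      by (intro CollectI conjI exI[of _ r]) (auto simp: rS(1) subset_dfa_def)
  qed
  ultimately show ?thesis by (auto simp: recognizes_def)
qed

theorem minimal_dfa_exists:
  "\<exists>M :: nat dfa. minimal_dfa p (padic_language p (path_set_fractal p G lab v0)) M"
proof -
  let ?L = "padic_language p (path_set_fractal p G lab v0)"
  have "\<exists>N :: nat dfa. recognizes p N ?L"
    using recognizes_nat[OF recognizes_subset_dfa] by (auto simp: padic_language_path_set_fractal)
  then obtain N :: "nat dfa" where "recognizes p N ?L" by blast
  from ex_has_least_nat[of "\<lambda>N. recognizes p N ?L", OF this, of "\<lambda>M. card (states M)"]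
  show ?thesis by (auto simp: minimal_dfa_def)
qed

end

end

theory Submission
  imports Defs
begin

text \<open>
  In a minimal automaton every state is reachable, and at most one state can be universal
  (able to read every finite word). Since successors of a universal state are universal, a
  universal state loops on all digits; this gives the equivalence with cylinders in the language.
  A cylinder has dimension 1 by comparison with Lebesgue measure. Without a universal state some
  word of a common length N is unreadable from each state, so at most \<open>(p ^ N - 1) ^ k\<close> of the
  \<open>p ^ (k * N)\<close> words of length \<open>k * N\<close> occur as prefixes, which forces dimension
  less than 1.
\<close>

section \<open>Finite runs of automata\<close>

fun run :: "'q dfa \<Rightarrow> 'q \<Rightarrow> nat list \<Rightarrow> 'q option" where
  "run M q [] = Some q"
| "run M q (i # w) = (case delta M q i of None \<Rightarrow> None | Some q' \<Rightarrow> run M q' w)"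

lemma run_append:
  "run M q (v @ w) = (case run M q v of None \<Rightarrow> None | Some q' \<Rightarrow> run M q' w)"
  by (induction v arbitrary: q) (auto split: option.splits)

lemma run_in_states:
  assumes "is_dfa p M" "q \<in> states M" "set w \<subseteq> {..<p}" "run M q w = Some q'"
  shows "q' \<in> states M"
  using assms(2-4)
proof (induction w arbitrary: q)
  case (Cons i w)
  then obtain t where t: "delta M q i = Some t" "run M t w = Some q'"
    by (auto split: option.splits)
  have "t \<in> states M" using assms(1) Cons.prems t(1) by (auto simp: is_dfa_def)
  then show ?case using Cons t by auto
qed simp

lemma set_prefix_digits: "c \<in> digit_seqs p \<Longrightarrow> set (prefix n c) \<subseteq> {..<p}"
  by (auto simp: digit_seqs_def subsequence_def)

lemma prefix_image_subset:
  "C \<subseteq> digit_seqs p \<Longrightarrow> prefix n ` C \<subseteq> {u. set u \<subseteq> {..<p} \<and> length u = n}"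
  by (auto simp: subset_iff digit_seqs_def subsequence_def)

lemma conc_digit_seqs:
  "set w \<subseteq> {..<p} \<Longrightarrow> x \<in> digit_seqs p \<Longrightarrow> w \<frown> x \<in> digit_seqs p"
  using nth_mem by (fastforce simp: digit_seqs_def conc_def)

text \<open>Determinism makes the run on each prefix unique, so the runs on all prefixes of
  \<open>c\<close> fit together into one infinite run without any compactness argument.\<close>

lemma dfa_language_iff_run:
  "c \<in> dfa_language p M \<longleftrightarrow> c \<in> digit_seqs p \<and> (\<forall>n. run M (start M) (prefix n c) \<noteq> None)"
proof (cases "c \<in> digit_seqs p")
  case True
  have "(\<exists>r. r 0 = start M \<and> (\<forall>n. delta M (r n) (c n) = Some (r (Suc n))))
    \<longleftrightarrow> (\<forall>n. run M (start M) (prefix n c) \<noteq> None)"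
  proof
    assume "\<exists>r. r 0 = start M \<and> (\<forall>n. delta M (r n) (c n) = Some (r (Suc n)))"
    then obtain r where r: "r 0 = start M" "\<And>n. delta M (r n) (c n) = Some (r (Suc n))" by blast
    have "run M (start M) (prefix n c) = Some (r n)" for n
      by (induction n) (simp_all add: subsequence_def run_append r)
    then show "\<forall>n. run M (start M) (prefix n c) \<noteq> None" by simp
  next
    assume R: "\<forall>n. run M (start M) (prefix n c) \<noteq> None"
    define r where "r n = the (run M (start M) (prefix n c))" for n
    have r: "run M (start M) (prefix n c) = Some (r n)" for n
      using R by (auto simp: r_def)
    have "delta M (r n) (c n) = Some (r (Suc n))" for n
      using r[of n] r[of "Suc n"] by (auto simp: subsequence_def run_append split: option.splits)
    moreover have "r 0 = start M" using r[of 0] by (simp add: subsequence_def)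
    ultimately show "\<exists>r. r 0 = start M \<and> (\<forall>n. delta M (r n) (c n) = Some (r (Suc n)))" by blast
  qed
  then show ?thesis using True by (simp add: dfa_language_def)
qed (simp add: dfa_language_def)

lemma dfa_languageD_run:
  assumes "w \<frown> x \<in> dfa_language p M"
  shows "run M (start M) (w @ prefix n x) \<noteq> None"
proof -
  have "prefix (length w + n) (w \<frown> x) = w @ prefix n x"
    by (rule nth_equalityI) (auto simp: subsequence_def conc_def nth_append)
  then show ?thesis using assms by (metis dfa_language_iff_run)
qed

lemma run_prefix_None: "run M q v = None \<Longrightarrow> run M q (v @ w) = None"
  by (simp add: run_append)

section \<open>Universal states and cylinders in the language\<close>

text \<open>Finite words suffice: since runs are deterministic, a state that reads all of them also
  reads every infinite digit sequence.\<close>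

definition universal_state :: "nat \<Rightarrow> 'q dfa \<Rightarrow> 'q \<Rightarrow> bool" where
  "universal_state p M q \<longleftrightarrow> (\<forall>u. set u \<subseteq> {..<p} \<longrightarrow> run M q u \<noteq> None)"

lemma universal_state_run:
  assumes "universal_state p M q" "set v \<subseteq> {..<p}" "run M q v = Some t"
  shows "universal_state p M t"
  unfolding universal_state_def
proof (intro allI impI)
  fix u :: "nat list" assume "set u \<subseteq> {..<p}"
  then have "run M q (v @ u) \<noteq> None" using assms(1,2) by (simp add: universal_state_def)
  then show "run M t u \<noteq> None" using assms(3) by (simp add: run_append)
qed

lemma cylinder_subset_iff_universal_state:
  assumes "p > 0" "set w \<subseteq> {..<p}"
  shows "{w \<frown> x | x. x \<in> digit_seqs p} \<subseteq> dfa_language p M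
    \<longleftrightarrow> (\<exists>q. run M (start M) w = Some q \<and> universal_state p M q)"
proof
  assume sub: "{w \<frown> x | x. x \<in> digit_seqs p} \<subseteq> dfa_language p M"
  have R: "run M (start M) (w @ u) \<noteq> None" if "set u \<subseteq> {..<p}" for u
  proof -
    have "(\<lambda>_. 0) \<in> digit_seqs p" using assms(1) by (simp add: digit_seqs_def)
    \<comment> \<open>Padding with zeros turns the finite word \<open>u\<close> into the start of a
      digit sequence; \<open>p > 0\<close> makes 0 a digit.\<close>
    then have "w \<frown> (u \<frown> (\<lambda>_. 0)) \<in> dfa_language p M"
      using sub conc_digit_seqs[OF that] by blast
    from dfa_languageD_run[OF this, of "length u"] show ?thesis by simp
  qed
  from R[of "[]"] obtain q where q: "run M (start M) w = Some q" by auto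
  have "universal_state p M q"
    using R q by (auto simp: universal_state_def run_append)
  with q show "\<exists>q. run M (start M) w = Some q \<and> universal_state p M q" by blast
next
  assume "\<exists>q. run M (start M) w = Some q \<and> universal_state p M q"
  then obtain q where q: "run M (start M) w = Some q" "universal_state p M q" by blast
  have "run M (start M) (prefix n (w \<frown> x)) \<noteq> None" if x: "x \<in> digit_seqs p" for x n
  proof
    assume "run M (start M) (prefix n (w \<frown> x)) = None"
    \<comment> \<open>The prefix may stop inside \<open>w\<close>. Appending the next
      \<open>length w\<close> letters gives \<open>w\<close> followed by \<open>prefix n x\<close>
      for every \<open>n\<close>, and a failed run stays failed under extension.\<close>
    then have "run M (start M) (prefix n (w \<frown> x) @ map (w \<frown> x) [n..<n + length w]) = None"
      by (rule run_prefix_None)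
    moreover have "prefix n (w \<frown> x) @ map (w \<frown> x) [n..<n + length w] = w @ prefix n x"
      by (rule nth_equalityI) (auto simp: subsequence_def conc_def nth_append)
    ultimately have "run M q (prefix n x) = None" using q(1) by (simp add: run_append)
    then show False using q(2) set_prefix_digits[OF x] unfolding universal_state_def by blast
  qed
  then show "{w \<frown> x | x. x \<in> digit_seqs p} \<subseteq> dfa_language p M"
    using conc_digit_seqs[OF assms(2)] by (auto simp: dfa_language_iff_run)
qed

section \<open>Minimal automata\<close>

lemma minimal_dfa_card_le:
  assumes "minimal_dfa p L M" "recognizes p N L"
  shows "card (states M) \<le> card (states N)"
  using assms recognizes_nat[OF assms(2)] by (metis minimal_dfa_def)

text \<open>Discarding the unreachable states keeps the language, so minimality leaves none to
  discard.\<close>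

lemma minimal_dfa_reachable:
  assumes "minimal_dfa p L M" "q \<in> states M"
  shows "\<exists>w. set w \<subseteq> {..<p} \<and> run M (start M) w = Some q"
proof -
  define R where "R = {q. \<exists>w. set w \<subseteq> {..<p} \<and> run M (start M) w = Some q}"
  have rec: "is_dfa p M" "dfa_language p M = L"
    using assms(1) by (auto simp: minimal_dfa_def recognizes_def)
  then have fin: "finite (states M)" and st: "start M \<in> states M" by (auto simp: is_dfa_def)
  have sub: "R \<subseteq> states M" using run_in_states[OF rec(1) st] by (auto simp: R_def)
  define N where "N = M\<lparr>states := R\<rparr>"
  have "start M \<in> R" unfolding R_def by (intro CollectI exI[of _ "[]"]) simp
  moreover have "q' \<in> R" if "q \<in> R" "i < p" "delta M q i = Some q'" for q i q'
  proof -
    obtain w where "set w \<subseteq> {..<p}" "run M (start M) w = Some q" using \<open>q \<in> R\<close> by (auto simp: R_def)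
    then show ?thesis unfolding R_def using that
      by (intro CollectI exI[of _ "w @ [i]"]) (simp add: run_append)
  qed
  ultimately have "is_dfa p N"
    using finite_subset[OF sub fin] by (auto simp: is_dfa_def N_def)
  \<comment> \<open>The language depends only on \<open>start\<close> and \<open>delta\<close>,
    which \<open>N\<close> shares with \<open>M\<close>.\<close>
  moreover have "dfa_language p N = L" using rec(2) by (simp add: N_def dfa_language_def)
  ultimately have "card (states M) \<le> card R"
    using minimal_dfa_card_le[OF assms(1), of N] by (simp add: recognizes_def N_def)
  then have "R = states M" using card_seteq[OF fin sub] by simp
  then show ?thesis using assms(2) by (auto simp: R_def)
qed

text \<open>Otherwise the universal states could be merged into one.\<close>

lemma minimal_dfa_universal_state_unique:
  assumes "minimal_dfa p L M"
    and "q \<in> states M" "universal_state p M q" "q' \<in> states M" "universal_state p M q'"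
  shows "q' = q"
proof -
  define F where "F = {t \<in> states M. universal_state p M t}"
  define f where "f t = (if t \<in> F then q else t)" for t
  define N where "N = \<lparr>states = f ` states M, start = f (start M),
    delta = (\<lambda>t i. map_option f (delta M t i))\<rparr>"
  have rec: "is_dfa p M" "dfa_language p M = L"
    using assms(1) by (auto simp: minimal_dfa_def recognizes_def)
  then have fin: "finite (states M)" and st: "start M \<in> states M"
    and cl: "\<And>t i t'. t \<in> states M \<Longrightarrow> i < p \<Longrightarrow> delta M t i = Some t' \<Longrightarrow> t' \<in> states M"
    by (auto simp: is_dfa_def)
  have qF: "q \<in> F" "q' \<in> F" using assms(2-5) by (auto simp: F_def)
  have f_states: "f t \<in> states M" if "t \<in> states M" for t
    using that assms(2) by (simp add: f_def)
  have N: "start N = f (start M)" "delta N t i = map_option f (delta M t i)" for t i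
    by (simp_all add: N_def)
  have dfa_N: "is_dfa p N" unfolding is_dfa_def
  proof (intro conjI ballI allI impI)
    fix t i t' assume "t \<in> states N" "i < p" "delta N t i = Some t'"
    then show "t' \<in> states N" using cl[of t i] f_states by (auto simp: N_def)
  qed (use fin st in \<open>auto simp: N_def\<close>)
  \<comment> \<open>\<open>N\<close> moves from the representative \<open>f t\<close> by the
    transitions of \<open>M\<close> at \<open>f t\<close>. When \<open>t\<close> lies in
    \<open>F\<close>, this is \<open>q\<close> instead of \<open>t\<close>; the two may have
    different successors, but neither ever fails.\<close>
  have run_N: "run N (f t) u = None \<longleftrightarrow> run M t u = None"
    if "t \<in> states M" "set u \<subseteq> {..<p}" for t u
    using that
  proof (induction u arbitrary: t)
    case (Cons i u)
    have i: "i < p" and u: "set u \<subseteq> {..<p}" using Cons.prems by auto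
    have *: "run N t' (i # u) = None \<longleftrightarrow> run M t' (i # u) = None" if "t' \<in> states M" for t'
      using Cons.IH[OF cl[OF that i] u] by (auto simp: N split: option.splits)
    show ?case
    proof (cases "t \<in> F")
      case True
      then have "run M t (i # u) \<noteq> None" "run M q (i # u) \<noteq> None"
        using Cons.prems(2) assms(3) unfolding F_def universal_state_def by blast+
      then show ?thesis using *[OF assms(2)] True by (simp add: f_def del: run.simps not_None_eq)
    next
      case False
      then show ?thesis using *[OF Cons.prems(1)] by (simp add: f_def del: run.simps)
    qed
  qed simp
  have "c \<in> dfa_language p N \<longleftrightarrow> c \<in> dfa_language p M" for c
    unfolding dfa_language_iff_run N(1) using run_N[OF st set_prefix_digits] by blast
  then have "dfa_language p N = L" using rec(2) by blast
  with dfa_N have "card (states M) \<le> card (f ` states M)"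
    using minimal_dfa_card_le[OF assms(1), of N] by (simp add: recognizes_def N_def)
  \<comment> \<open>Minimality forbids \<open>f\<close> from lowering the number of states, so
    \<open>f\<close> is injective; yet it sends both \<open>q\<close> and \<open>q'\<close> to
    \<open>q\<close>.\<close>
  then have "inj_on f (states M)" using fin card_image_le[OF fin, of f] by (intro eq_card_imp_inj_on) auto
  then show ?thesis using assms(2,4) qF by (auto simp: inj_on_def f_def)
qed

lemma minimal_dfa_loop_iff_universal_state:
  assumes "minimal_dfa p L M" "q \<in> states M"
  shows "(\<forall>i<p. delta M q i = Some q) \<longleftrightarrow> universal_state p M q"
proof
  assume loop: "\<forall>i<p. delta M q i = Some q"
  have "run M q u = Some q" if "set u \<subseteq> {..<p}" for u
    using that by (induction u) (use loop in auto)
  then show "universal_state p M q" by (simp add: universal_state_def)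
next
  assume U: "universal_state p M q"
  show "\<forall>i<p. delta M q i = Some q"
  proof (intro allI impI)
    fix i assume i: "i < p"
    then have "run M q [i] \<noteq> None" using U by (auto simp: universal_state_def simp del: run.simps)
    then obtain t where t: "run M q [i] = Some t" "delta M q i = Some t" by (auto split: option.splits)
    have "universal_state p M t" using universal_state_run[OF U _ t(1)] i by simp
    moreover have "t \<in> states M"
      using assms i t(2) by (auto simp: minimal_dfa_def recognizes_def is_dfa_def)
    ultimately show "delta M q i = Some q"
      using minimal_dfa_universal_state_unique[OF assms(1,2) U] t(2) by blast
  qed
qed

text \<open>A looping state is a universal one, and reachability supplies a word leading to it; that
  word spans the cylinder. Conversely, \<open>w\<close> leads to a universal state.\<close>

lemma minimal_dfa_loop_iff_cylinder:
  assumes "minimal_dfa p L M" "p > 0"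
  shows "(\<exists>q\<in>states M. \<forall>i<p. delta M q i = Some q)
    \<longleftrightarrow> (\<exists>w. set w \<subseteq> {..<p} \<and> {w \<frown> x | x. x \<in> digit_seqs p} \<subseteq> L)"
proof -
  have rec: "is_dfa p M" "dfa_language p M = L" "start M \<in> states M"
    using assms(1) by (auto simp: minimal_dfa_def recognizes_def is_dfa_def)
  have "(\<exists>q\<in>states M. \<forall>i<p. delta M q i = Some q) \<longleftrightarrow> (\<exists>q\<in>states M. universal_state p M q)"
    using minimal_dfa_loop_iff_universal_state[OF assms(1)] by blast
  also have "\<dots> \<longleftrightarrow> (\<exists>w. set w \<subseteq> {..<p} \<and> (\<exists>q. run M (start M) w = Some q \<and> universal_state p M q))"
    using minimal_dfa_reachable[OF assms(1)] run_in_states[OF rec(1,3)] by blast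
  also have "\<dots> \<longleftrightarrow> (\<exists>w. set w \<subseteq> {..<p} \<and> {w \<frown> x | x. x \<in> digit_seqs p} \<subseteq> L)"
    unfolding rec(2)[symmetric]
    by (intro ex_cong1 conj_cong refl) (simp only: cylinder_subset_iff_universal_state[OF assms(2)])
  finally show ?thesis .
qed

section \<open>Growth of the set of readable words\<close>

definition readable :: "nat \<Rightarrow> 'q dfa \<Rightarrow> 'q \<Rightarrow> nat \<Rightarrow> nat list set" where
  "readable p M q n = {u. set u \<subseteq> {..<p} \<and> length u = n \<and> run M q u \<noteq> None}"

lemma finite_readable: "finite (readable p M q n)"
  by (rule finite_subset[OF _ finite_lists_length_eq[of "{..<p}" n]]) (auto simp: readable_def)

text \<open>Each state has its own unreadable word. Padding all of them to one common length costs
  every state at least one word of that length.\<close>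

lemma uniformly_unreadable_word:
  assumes "p > 0" "is_dfa p M" "\<forall>q\<in>states M. \<not> universal_state p M q"
  obtains N where "\<And>q. q \<in> states M \<Longrightarrow> card (readable p M q N) \<le> p ^ N - 1" "N > 0"
proof -
  have "\<forall>q\<in>states M. \<exists>u. set u \<subseteq> {..<p} \<and> run M q u = None"
    using assms(3) by (auto simp: universal_state_def)
  then obtain u where u: "\<And>q. q \<in> states M \<Longrightarrow> set (u q) \<subseteq> {..<p} \<and> run M q (u q) = None" by metis
  \<comment> \<open>The sum bounds each individual length; \<open>Suc\<close> ensures
    \<open>N > 0\<close>.\<close>
  define N where "N = Suc (\<Sum>q\<in>states M. length (u q))"
  have fin: "finite (states M)" using assms(2) by (simp add: is_dfa_def)
  have "card (readable p M q N) \<le> p ^ N - 1" if q: "q \<in> states M" for q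
  proof -
    let ?W = "{v. set v \<subseteq> {..<p} \<and> length v = N}"
    let ?v = "u q @ replicate (N - length (u q)) 0"
    have "length (u q) \<le> N"
      using member_le_sum[OF q, of "\<lambda>q. length (u q)"] fin by (simp add: N_def)
    then have v: "?v \<in> ?W" using u[OF q] assms(1) by auto
    have "run M q ?v = None" using u[OF q] by (simp add: run_append)
    then have "readable p M q N \<subseteq> ?W - {?v}" by (auto simp: readable_def)
    then have "card (readable p M q N) \<le> card (?W - {?v})"
      by (intro card_mono finite_Diff finite_lists_length_eq) auto
    also have "\<dots> = p ^ N - 1" using v by (simp add: card_lists_length_eq)
    finally show ?thesis .
  qed
  then show ?thesis using that[of N] by (simp add: N_def)
qed

text \<open>A readable word splits into its first \<open>N\<close> letters, with at most
  \<open>B\<close> choices, and a word readable from the state reached, to which induction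
  applies.\<close>

lemma card_readable_le_power:
  assumes "is_dfa p M" "\<And>q. q \<in> states M \<Longrightarrow> card (readable p M q N) \<le> B" "q \<in> states M"
  shows "card (readable p M q (k * N)) \<le> B ^ k"
  using assms(3)
proof (induction k arbitrary: q)
  case 0
  have "readable p M q 0 = {[]}" by (auto simp: readable_def)
  then show ?case by simp
next
  case (Suc k)
  \<comment> \<open>For \<open>u\<close> in \<open>readable p M q N\<close> the run is defined, so
    \<open>the\<close> returns the actual state reached.\<close>
  let ?T = "\<lambda>u. readable p M (the (run M q u)) (k * N)"
  have "readable p M q (Suc k * N) \<subseteq> (\<Union>u\<in>readable p M q N. (@) u ` ?T u)"
  proof
    fix v assume v: "v \<in> readable p M q (Suc k * N)"
    have "run M q (take N v @ drop N v) \<noteq> None" using v by (simp add: readable_def)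
    then obtain t where t: "run M q (take N v) = Some t" "run M t (drop N v) \<noteq> None"
      by (auto simp: run_append simp del: append_take_drop_id split: option.splits)
    have "take N v \<in> readable p M q N" "drop N v \<in> ?T (take N v)"
      using v t set_take_subset[of N v] set_drop_subset[of N v] by (auto simp: readable_def)
    then show "v \<in> (\<Union>u\<in>readable p M q N. (@) u ` ?T u)"
      by (intro UN_I[of "take N v"] image_eqI[of _ _ "drop N v"]) auto
  qed
  then have "card (readable p M q (Suc k * N)) \<le> card (\<Union>u\<in>readable p M q N. (@) u ` ?T u)"
    by (intro card_mono) (auto intro: finite_readable)
  also have "\<dots> \<le> (\<Sum>u\<in>readable p M q N. card ((@) u ` ?T u))"
    by (rule card_UN_le[OF finite_readable])
  also have "\<dots> \<le> (\<Sum>u\<in>readable p M q N. B ^ k)"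
  proof (rule sum_mono)
    fix u assume u: "u \<in> readable p M q N"
    have "the (run M q u) \<in> states M"
      using u run_in_states[OF assms(1) Suc.prems] by (auto simp: readable_def)
    then show "card ((@) u ` ?T u) \<le> B ^ k"
      by (rule order_trans[OF card_image_le[OF finite_readable] Suc.IH])
  qed
  also have "\<dots> \<le> B ^ Suc k" using assms(2)[OF Suc.prems] by simp
  finally show ?case .
qed

section \<open>Hausdorff dimension of sets of p-adic integers\<close>

lemma padic_dist_le:
  assumes "p > 1" "\<And>i. i < n \<Longrightarrow> c i = d i"
  shows "padic_dist p (padic_of_digits p c) (padic_of_digits p d) \<le> (1 / real p) ^ n"
  unfolding padic_dist_def
proof (rule padic_norm_le[OF assms(1)])
  fix m assume "m \<le> n"
  then have "(\<Sum>i<m. int (c i) * int p ^ i) = (\<Sum>i<m. int (d i) * int p ^ i)"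
    by (intro sum.cong) (auto simp: assms(2))
  then show "padic_diff p (padic_of_digits p c) (padic_of_digits p d) m = 0"
    by (simp add: padic_diff_def padic_of_digits_def)
qed

text \<open>Modulo \<open>p ^ Suc n\<close> the difference is \<open>(c n - d n) * p ^ n\<close>. It
  does not vanish, because two distinct digits differ by less than \<open>p\<close>; hence the
  valuation is at most \<open>n\<close>.\<close>

lemma padic_dist_ge:
  assumes "p > 1" "c \<in> digit_seqs p" "d \<in> digit_seqs p"
    and "\<And>i. i < n \<Longrightarrow> c i = d i" "c n \<noteq> d n"
  shows "(1 / real p) ^ n \<le> padic_dist p (padic_of_digits p c) (padic_of_digits p d)"
proof -
  let ?z = "padic_diff p (padic_of_digits p c) (padic_of_digits p d)"
  have "(\<Sum>i<n. int (c i) * int p ^ i) = (\<Sum>i<n. int (d i) * int p ^ i)"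
    by (intro sum.cong) (auto simp: assms(4))
  then have "(\<Sum>i<Suc n. int (c i) * int p ^ i) - (\<Sum>i<Suc n. int (d i) * int p ^ i)
      = (int (c n) - int (d n)) * int p ^ n"
    by (simp add: algebra_simps)
  then have z: "?z (Suc n) = ((int (c n) - int (d n)) * int p ^ n) mod int p ^ Suc n"
    by (simp only: padic_diff_def padic_of_digits_def mod_diff_eq)
  have "?z (Suc n) \<noteq> 0"
  proof
    assume "?z (Suc n) = 0"
    then have "int p ^ Suc n dvd (int (c n) - int (d n)) * int p ^ n"
      unfolding z by (rule mod_0_imp_dvd)
    then have "int p dvd int (c n) - int (d n)" using assms(1) by simp
    moreover have "c n < p" "d n < p" using assms(2,3) by (auto simp: digit_seqs_def)
    ultimately show False using assms(5) zdvd_imp_le[of "int p" "\<bar>int (c n) - int (d n)\<bar>"] by auto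
  qed
  then have "padic_val ?z \<le> n" "?z \<noteq> (\<lambda>_. 0)"
    unfolding padic_val_def by (auto intro: Least_le)
  then show ?thesis using assms(1) by (simp add: padic_dist_def padic_norm_def power_decreasing)
qed

section \<open>Upper bounds from covers by cylinders\<close>

text \<open>The cover consists of one cylinder for each word in \<open>W\<close>, and sequences
  sharing \<open>n\<close> digits are within \<open>p\<close> to the power \<open>-n\<close> of each
  other.\<close>

lemma hausdorff_content_le_cylinders:
  assumes "p > 1" "s > 0" "finite W" "\<And>c. c \<in> C \<Longrightarrow> prefix n c \<in> W" "(1 / real p) ^ n \<le> \<delta>"
  shows "hausdorff_content (padic_int p) (padic_dist p) s \<delta> (padic_of_digits p ` C)
    \<le> ennreal (real (card W) * ((1 / real p) ^ n) powr s)"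
proof -
  let ?r = "(1 / real p) ^ n"
  obtain h where h: "bij_betw h {0..<card W} W" using ex_bij_betw_nat_finite[OF assms(3)] by blast
  \<comment> \<open>The remaining indices carry the empty set, of diameter 0, so the series reduces
    to \<open>card W\<close> terms.\<close>
  define U where "U i = (if i < card W then padic_of_digits p ` {c. prefix n c = h i} else {})" for i
  have diam: "ediam (padic_dist p) (U i) \<le> ennreal ?r" for i
    unfolding ediam_def
  proof (intro SUP_least ennreal_leI)
    fix x y assume "x \<in> U i" "y \<in> U i"
    then obtain c d where cd: "x = padic_of_digits p c" "y = padic_of_digits p d"
        "prefix n c = prefix n d"
      by (auto simp: U_def split: if_splits)
    have "c i = d i" if "i < n" for i using cd(3) that by (auto simp: subsequence_def)
    then show "padic_dist p x y \<le> ?r" unfolding cd(1,2) by (rule padic_dist_le[OF assms(1)])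
  qed
  have "U i \<subseteq> padic_int p" for i
    using assms(1) by (auto simp: U_def intro!: padic_of_digits_in_padic_int)
  moreover have "ediam (padic_dist p) (U i) \<le> ennreal \<delta>" for i
    using diam[of i] ennreal_leI[OF assms(5)] order_trans by blast
  moreover have "padic_of_digits p ` C \<subseteq> (\<Union>i. U i)"
  proof
    fix x assume "x \<in> padic_of_digits p ` C"
    then obtain c where c: "x = padic_of_digits p c" "prefix n c \<in> W" using assms(4) by blast
    then obtain i where "i < card W" "h i = prefix n c" using h by (force simp: bij_betw_def)
    then show "x \<in> (\<Union>i. U i)" using c(1) by (intro UN_I[of i]) (auto simp: U_def)
  qed
  ultimately have "hausdorff_content (padic_int p) (padic_dist p) s \<delta> (padic_of_digits p ` C)
      \<le> (\<Sum>i. ennreal (enn2real (ediam (padic_dist p) (U i)) powr s))"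
    unfolding hausdorff_content_def by (intro Inf_lower) blast
  also have "\<dots> = (\<Sum>i<card W. ennreal (enn2real (ediam (padic_dist p) (U i)) powr s))"
    by (rule suminf_finite) (auto simp: U_def ediam_def bot_ennreal)
  also have "\<dots> \<le> (\<Sum>i<card W. ennreal (?r powr s))"
  proof (rule sum_mono)
    fix i
    have "enn2real (ediam (padic_dist p) (U i)) \<le> ?r"
      using diam[of i] assms(1) by (intro enn2real_leI) auto
    then show "ennreal (enn2real (ediam (padic_dist p) (U i)) powr s) \<le> ennreal (?r powr s)"
      using assms(2) by (intro ennreal_leI powr_mono2) auto
  qed
  also have "\<dots> = ennreal (real (card W) * ?r powr s)"
    by (simp add: ennreal_mult'' ennreal_of_nat_eq_real_of_nat)
  finally show ?thesis .
qed

text \<open>A box-counting bound: covering by cylinders of length \<open>k * N\<close> gives content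
  at most \<open>?q ^ k\<close>, and the hypothesis on \<open>B\<close> says exactly that
  \<open>?q < 1\<close>.\<close>

lemma hausdorff_measure_zero_of_growth:
  assumes p: "p > 1" and s: "s > 0" and N: "N > 0" and C: "C \<subseteq> digit_seqs p"
    and card: "\<And>k. card (prefix (k * N) ` C) \<le> B ^ k"
    and B: "real B < real p powr (real N * s)"
  shows "hausdorff_measure (padic_int p) (padic_dist p) s (padic_of_digits p ` C) = 0"
proof -
  let ?q = "real B / real p powr (real N * s)"
  have q: "0 \<le> ?q" "?q < 1" using B p by auto
  have "hausdorff_content (padic_int p) (padic_dist p) s \<delta> (padic_of_digits p ` C) = 0"
    (is "?H = 0") if \<delta>: "\<delta> > 0" for \<delta>
  proof -
    have le: "?H \<le> ennreal (?q ^ k)" if k: "((1 / real p) ^ N) ^ k \<le> \<delta>" for k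
    proof -
      have fin: "finite (prefix (k * N) ` C)"
        by (rule finite_subset[OF prefix_image_subset[OF C] finite_lists_length_eq]) simp
      have pw: "((1 / real p) ^ (k * N)) powr s = (1 / real p powr (real N * s)) ^ k"
        using p by (simp add: powr_realpow[symmetric] powr_powr powr_divide power_divide
            powr_power mult_ac)
      have "?H \<le> ennreal (real (card (prefix (k * N) ` C)) * ((1 / real p) ^ (k * N)) powr s)"
        using k by (intro hausdorff_content_le_cylinders p s fin)
          (auto simp: power_mult[symmetric] mult.commute)
      also have "\<dots> \<le> ennreal (real (B ^ k) * ((1 / real p) ^ (k * N)) powr s)"
        by (intro ennreal_leI mult_right_mono of_nat_mono card) simp
      also have "\<dots> = ennreal (?q ^ k)" unfolding pw by (simp add: power_divide)
      finally show ?thesis .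
    qed
    \<comment> \<open>A cover at level \<open>k\<close> is admissible only once its mesh is below
      \<delta>, which holds for all large \<open>k\<close> because \<open>N > 0\<close>.\<close>
    have "(1 / real p) ^ N < 1" using p N by (intro power_less_one_iff[THEN iffD2]) auto
    then have "(\<lambda>k. ((1 / real p) ^ N) ^ k) \<longlonglongrightarrow> 0" by (intro LIMSEQ_power_zero) simp
    from order_tendstoD(2)[OF this \<delta>]
    have ev: "\<forall>\<^sub>F k in sequentially. ?H \<le> ennreal (?q ^ k)"
      by eventually_elim (simp add: le)
    have lim: "(\<lambda>k. ennreal (?q ^ k)) \<longlonglongrightarrow> ennreal 0"
      using q by (intro tendsto_ennrealI LIMSEQ_power_zero) simp
    have "?H \<le> ennreal 0" by (rule tendsto_lowerbound[OF lim ev]) simp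
    then show ?thesis by simp
  qed
  then show ?thesis unfolding hausdorff_measure_def by (auto simp: SUP_eq_const)
qed

lemma hausdorff_dim_leI:
  "s > 0 \<Longrightarrow> hausdorff_measure M d s E = 0 \<Longrightarrow> hausdorff_dim M d E \<le> ennreal s"
  unfolding hausdorff_dim_def by (intro Inf_lower) blast

text \<open>There are at most \<open>p ^ k\<close> prefixes of length \<open>k\<close>, so the
  measure vanishes for each exponent \<open>1 + e\<close> with \<open>e > 0\<close>.\<close>

lemma hausdorff_dim_padic_le_one:
  assumes "p > 1" "C \<subseteq> digit_seqs p"
  shows "hausdorff_dim (padic_int p) (padic_dist p) (padic_of_digits p ` C) \<le> 1"
proof (rule ennreal_le_epsilon)
  fix e :: real assume e: "e > 0"
  have "card (prefix (k * 1) ` C) \<le> p ^ k" for k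
  proof -
    have "card (prefix (k * 1) ` C) \<le> card {u. set u \<subseteq> {..<p} \<and> length u = k}"
      using prefix_image_subset[OF assms(2), of k] by (intro card_mono finite_lists_length_eq) simp_all
    then show ?thesis by (simp add: card_lists_length_eq)
  qed
  moreover have "real p < real p powr (real 1 * (1 + e))"
    using powr_less_mono[of 1 "1 + e" "real p"] assms(1) e by simp
  ultimately have "hausdorff_measure (padic_int p) (padic_dist p) (1 + e) (padic_of_digits p ` C) = 0"
    using assms e by (intro hausdorff_measure_zero_of_growth[where N = 1 and B = p]) auto
  then have "hausdorff_dim (padic_int p) (padic_dist p) (padic_of_digits p ` C) \<le> ennreal (1 + e)"
    using e by (intro hausdorff_dim_leI) auto
  then show "hausdorff_dim (padic_int p) (padic_dist p) (padic_of_digits p ` C) \<le> 1 + ennreal e"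
    using e by simp
qed

lemma hausdorff_dim_padic_less_one:
  assumes p: "p > 1" and N: "N > 0" and C: "C \<subseteq> digit_seqs p"
    and card: "\<And>k. card (prefix (k * N) ` C) \<le> (p ^ N - 1) ^ k"
  shows "hausdorff_dim (padic_int p) (padic_dist p) (padic_of_digits p ` C) < 1"
proof -
  define P where "P = real p ^ N"
  have "real p \<le> P" using p N power_increasing[of 1 N "real p"] by (simp add: P_def)
  then have P: "P \<ge> 2" using p by linarith
  \<comment> \<open>This solves \<open>P powr s = P - 1 / 2\<close>, a value strictly between the
    growth bound \<open>P - 1\<close> and \<open>P\<close>. The upper comparison gives
    \<open>s < 1\<close>, and \<open>P \<ge> 2\<close> gives \<open>P - 1 / 2 > 1\<close>, hence
    \<open>s > 0\<close>.\<close>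
  define s where "s = ln (P - 1 / 2) / ln P"
  have s: "s > 0" "s < 1" using P by (auto simp: s_def)
  have "real p powr (real N * s) = P powr s"
    using p by (simp add: P_def powr_powr[symmetric] powr_realpow)
  also have "\<dots> = P - 1 / 2" using P by (simp add: s_def powr_def)
  finally have "real (p ^ N - 1) < real p powr (real N * s)"
    using p by (simp add: P_def of_nat_diff)
  then have "hausdorff_measure (padic_int p) (padic_dist p) s (padic_of_digits p ` C) = 0"
    by (rule hausdorff_measure_zero_of_growth[OF p s(1) N C card])
  then have "hausdorff_dim (padic_int p) (padic_dist p) (padic_of_digits p ` C) \<le> ennreal s"
    by (rule hausdorff_dim_leI[OF s(1)])
  also have "\<dots> < 1" using s by simp
  finally show ?thesis .
qed

section \<open>Lower bounds by comparison with Lebesgue measure\<close>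

text \<open>On \<open>[0, 1)\<close> these are the base-p digits after the point. The most
  significant one has index 0 and so becomes the p-adic digit that matters most for the
  distance.\<close>

definition real_digits :: "nat \<Rightarrow> real \<Rightarrow> nat word" where
  "real_digits p t = (\<lambda>i. nat (\<lfloor>t * real p ^ Suc i\<rfloor> mod int p))"

lemma real_digits_in_digit_seqs: "p > 0 \<Longrightarrow> real_digits p t \<in> digit_seqs p"
  by (auto simp: real_digits_def digit_seqs_def nat_less_iff)

text \<open>The first \<open>n\<close> digits determine the floor of \<open>t * p ^ n\<close>, and
  two numbers with equal floors differ by less than 1.\<close>

lemma real_digits_close:
  assumes "p > 0" "t \<in> {0..<1}" "u \<in> {0..<1}"
    and "\<And>i. i < n \<Longrightarrow> real_digits p t i = real_digits p u i"
  shows "\<bar>t - u\<bar> \<le> (1 / real p) ^ n"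
proof -
  have "\<lfloor>t * real p ^ n\<rfloor> = \<lfloor>u * real p ^ n\<rfloor>"
    using assms(4)
  proof (induction n)
    case 0
    have "\<lfloor>t\<rfloor> = 0" "\<lfloor>u\<rfloor> = 0" using assms(2,3) by (auto simp: floor_eq_iff)
    then show ?case by simp
  next
    case (Suc n)
    \<comment> \<open>Division by \<open>p\<close> drops the last digit: the quotient is settled by
      induction, the remainder is the digit of index \<open>n\<close>.\<close>
    have div: "\<lfloor>x * real p ^ Suc n\<rfloor> div int p = \<lfloor>x * real p ^ n\<rfloor>" for x
      using floor_divide_real_eq_div[of "int p" "x * real p ^ Suc n"] assms(1) by simp
    have "nat (\<lfloor>t * real p ^ Suc n\<rfloor> mod int p) = nat (\<lfloor>u * real p ^ Suc n\<rfloor> mod int p)"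
      using Suc.prems[of n] by (simp add: real_digits_def)
    then have "\<lfloor>t * real p ^ Suc n\<rfloor> mod int p = \<lfloor>u * real p ^ Suc n\<rfloor> mod int p"
      using assms(1) by (simp only: eq_nat_nat_iff pos_mod_sign of_nat_0_less_iff)
    moreover have "\<lfloor>t * real p ^ Suc n\<rfloor> div int p = \<lfloor>u * real p ^ Suc n\<rfloor> div int p"
      using Suc by (simp only: div)
    ultimately show ?case by (metis mult_div_mod_eq)
  qed
  then have "\<bar>t * real p ^ n - u * real p ^ n\<bar> < 1" by linarith
  then have "\<bar>t - u\<bar> * real p ^ n < 1" by (simp add: left_diff_distrib[symmetric] abs_mult)
  then show ?thesis using assms(1) by (simp add: field_simps)
qed

text \<open>If \<open>n\<close> is the first index where the real digits differ, then
  \<open>t\<close> and \<open>u\<close> are within \<open>p\<close> to the power \<open>-n\<close>,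
  while the p-adic distance is at least \<open>p\<close> to the power
  \<open>-(length w + n)\<close>. The map back to the reals is thus Lipschitz.\<close>

lemma padic_dist_real_digits_ge:
  assumes p: "p > 1" and w: "set w \<subseteq> {..<p}" and t: "t \<in> {0..<1}" and u: "u \<in> {0..<1}"
  shows "\<bar>t - u\<bar> \<le> real p ^ length w *
    padic_dist p (padic_of_digits p (w \<frown> real_digits p t)) (padic_of_digits p (w \<frown> real_digits p u))"
    (is "_ \<le> _ * padic_dist _ (padic_of_digits _ ?c) (padic_of_digits _ ?d)")
proof (cases "t = u")
  case True
  then show ?thesis by (simp add: padic_dist_def padic_norm_def)
next
  case False
  have c: "?c \<in> digit_seqs p" "?d \<in> digit_seqs p"
    using conc_digit_seqs[OF w] real_digits_in_digit_seqs p by auto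
  have "\<exists>n. real_digits p t n \<noteq> real_digits p u n"
  proof (rule ccontr)
    assume "\<not> ?thesis"
    then have "\<bar>t - u\<bar> \<le> (1 / real p) ^ n" for n
      using real_digits_close[of p t u n] p t u by simp
    moreover have "(\<lambda>n. (1 / real p) ^ n) \<longlonglongrightarrow> 0" using p by (intro LIMSEQ_power_zero) simp
    ultimately have "\<bar>t - u\<bar> \<le> 0" by (intro tendsto_lowerbound[of _ 0 sequentially]) auto
    then show False using False by simp
  qed
  then obtain n where n: "real_digits p t n \<noteq> real_digits p u n"
    "\<And>i. i < n \<Longrightarrow> real_digits p t i = real_digits p u i"
    using exists_least_iff[of "\<lambda>n. real_digits p t n \<noteq> real_digits p u n"] by blast
  have "(1 / real p) ^ (length w + n) \<le> padic_dist p (padic_of_digits p ?c) (padic_of_digits p ?d)"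
    using n by (intro padic_dist_ge p c) (auto simp: conc_def)
  then have "real p ^ length w * (1 / real p) ^ (length w + n)
      \<le> real p ^ length w * padic_dist p (padic_of_digits p ?c) (padic_of_digits p ?d)"
    by (intro mult_left_mono) auto
  moreover have "real p ^ length w * (1 / real p) ^ (length w + n) = (1 / real p) ^ n"
    using p by (simp add: power_add power_divide)
  moreover have "\<bar>t - u\<bar> \<le> (1 / real p) ^ n" using p t u n by (intro real_digits_close) auto
  ultimately show ?thesis by linarith
qed

text \<open>
  A cover of the cylinder pulls back along the base-p digit map to a cover of \<open>[0, 1)\<close> by sets
  of comparable diameter, so the sum of the diameters is bounded below by Lebesgue measure.
\<close>

lemma hausdorff_content_cylinder_ge:
  assumes p: "p > 1" and s: "s \<le> 1" and w: "set w \<subseteq> {..<p}"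
    and E: "\<And>x. x \<in> digit_seqs p \<Longrightarrow> padic_of_digits p (w \<frown> x) \<in> E"
  shows "ennreal (1 / (2 * real p ^ length w)) \<le> hausdorff_content (padic_int p) (padic_dist p) s 1 E"
  unfolding hausdorff_content_def
proof (rule Inf_greatest, clarify)
  fix U :: "nat \<Rightarrow> (nat \<Rightarrow> int) set"
  assume U: "\<forall>i. U i \<subseteq> padic_int p \<and> ediam (padic_dist p) (U i) \<le> ennreal 1"
    and cover: "E \<subseteq> (\<Union>i. U i)"
  define D where "D i = enn2real (ediam (padic_dist p) (U i))" for i
  define c where "c = real p ^ length w"
  define g where "g t = padic_of_digits p (w \<frown> real_digits p t)" for t
  define A where "A i = {t \<in> {0..<1}. g t \<in> U i}" for i
  \<comment> \<open>If \<open>A i\<close> is empty, \<open>a i\<close> is an arbitrary real; the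
    interval around it then only enlarges the cover.\<close>
  define a where "a i = (SOME t. t \<in> A i)" for i
  \<comment> \<open>The radius is the Lipschitz constant \<open>c\<close> times the diameter; the
    length \<open>2 * c * D i\<close> produces the factor 2 in the bound.\<close>
  define I where "I i = {a i - c * D i..a i + c * D i}" for i
  have c: "c > 0" using p by (simp add: c_def)
  \<comment> \<open>Finite diameters make \<open>enn2real\<close> lossless.\<close>
  have fin: "ediam (padic_dist p) (U i) < top_class.top" for i
    using U by (metis ennreal_less_top order_le_less_trans)
  have D: "0 \<le> D i" "D i \<le> 1" for i
    using U by (auto simp: D_def intro!: enn2real_leI)
  have dist: "padic_dist p x y \<le> D i" if "x \<in> U i" "y \<in> U i" for x y i
  proof -
    have "ennreal (padic_dist p x y) \<le> ediam (padic_dist p) (U i)"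
      unfolding ediam_def using that by (intro SUP_upper2[of x] SUP_upper)
    also have "\<dots> = ennreal (D i)" using fin[of i] by (simp add: D_def)
    finally show ?thesis using D(1) by (simp add: ennreal_le_iff)
  qed
  have AI: "A i \<subseteq> I i" for i
  proof
    fix t assume t: "t \<in> A i"
    then have ai: "a i \<in> A i" unfolding a_def by (rule someI)
    have "\<bar>t - a i\<bar> \<le> c * padic_dist p (g t) (g (a i))"
      unfolding c_def g_def using t ai by (intro padic_dist_real_digits_ge p w) (auto simp: A_def)
    also have "\<dots> \<le> c * D i"
      using t ai c by (intro mult_left_mono dist) (auto simp: A_def)
    finally show "t \<in> I i" unfolding I_def by auto
  qed
  have "{0..<1} \<subseteq> (\<Union>i. I i)"
  proof
    fix t :: real assume t: "t \<in> {0..<1}"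
    have "g t \<in> E" unfolding g_def using p by (intro E real_digits_in_digit_seqs) simp
    then obtain i where "g t \<in> U i" using cover by blast
    then show "t \<in> (\<Union>i. I i)" using t AI[of i] by (auto simp: A_def)
  qed
  then have "emeasure lborel {0..<1::real} \<le> emeasure lborel (\<Union>i. I i)"
    by (intro emeasure_mono) (auto simp: I_def)
  also have "\<dots> \<le> (\<Sum>i. emeasure lborel (I i))"
    by (intro emeasure_subadditive_countably) (auto simp: I_def)
  also have "\<dots> = (\<Sum>i. ennreal (2 * c) * ennreal (D i))"
    using c D(1) by (intro suminf_cong) (simp add: I_def ennreal_mult[symmetric] mult.assoc)
  also have "\<dots> = ennreal (2 * c) * (\<Sum>i. ennreal (D i))" by (rule ennreal_suminf_cmult)
  also have "\<dots> \<le> ennreal (2 * c) * (\<Sum>i. ennreal (D i powr s))"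
  proof (intro mult_left_mono suminf_le ennreal_leI)
    fix i
    \<comment> \<open>The scale 1 gives \<open>D i \<le> 1\<close>, so lowering the exponent from 1
      to \<open>s\<close> cannot decrease the term.\<close>
    show "D i \<le> D i powr s"
    proof (cases "D i = 0")
      case False
      then show ?thesis using powr_mono'[of s 1 "D i"] D[of i] s by simp
    qed simp
  qed auto
  finally have "1 \<le> ennreal (2 * c) * (\<Sum>i. ennreal (D i powr s))" by simp
  then have "ennreal (1 / (2 * c)) * 1
      \<le> ennreal (1 / (2 * c)) * (ennreal (2 * c) * (\<Sum>i. ennreal (D i powr s)))"
    by (rule mult_left_mono) simp
  also have "\<dots> = (\<Sum>i. ennreal (D i powr s))"
    using c by (simp add: mult.assoc[symmetric] ennreal_mult[symmetric])
  finally show "ennreal (1 / (2 * real p ^ length w))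
      \<le> (\<Sum>i. ennreal (enn2real (ediam (padic_dist p) (U i)) powr s))"
    by (simp add: c_def D_def)
qed

text \<open>At scale 1 the content is bounded below by a positive constant for every
  \<open>s \<le> 1\<close>, and the measure is a supremum over scales; so no such exponent gives
  measure zero.\<close>

lemma hausdorff_dim_cylinder_ge_one:
  assumes p: "p > 1" and w: "set w \<subseteq> {..<p}"
    and E: "\<And>x. x \<in> digit_seqs p \<Longrightarrow> padic_of_digits p (w \<frown> x) \<in> E"
  shows "1 \<le> hausdorff_dim (padic_int p) (padic_dist p) E"
  unfolding hausdorff_dim_def
proof (rule Inf_greatest, clarify)
  fix s :: real assume s: "s > 0" and zero: "hausdorff_measure (padic_int p) (padic_dist p) s E = 0"
  show "1 \<le> ennreal s"
  proof (rule ccontr)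
    assume "\<not> 1 \<le> ennreal s"
    then have "s \<le> 1" by (metis ennreal_1 ennreal_leI linear)
    have "ennreal (1 / (2 * real p ^ length w))
        \<le> hausdorff_content (padic_int p) (padic_dist p) s 1 E"
      by (rule hausdorff_content_cylinder_ge[OF p \<open>s \<le> 1\<close> w E])
    also have "\<dots> \<le> hausdorff_measure (padic_int p) (padic_dist p) s E"
      unfolding hausdorff_measure_def by (intro SUP_upper) simp
    finally have "1 / (2 * real p ^ length w) \<le> 0" using zero by (simp add: ennreal_eq_0_iff)
    moreover have "0 < 1 / (2 * real p ^ length w)" using p by simp
    ultimately show False by linarith
  qed
qed

section \<open>Equivalence of the three conditions\<close>

theorem theorem4p1:
  fixes p :: nat
    and G :: "('v, 'e) pre_digraph" and lab :: "'e \<Rightarrow> nat" and v0 :: 'v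
    and K :: "(nat \<Rightarrow> int) set"
    and M :: "'q dfa"
  assumes "prime p"
    and "path_presentation G p lab v0"
    and "K = path_set_fractal p G lab v0"
    and "minimal_dfa p (padic_language p K) M"
  shows "(hausdorff_dim (padic_int p) (padic_dist p) K = 1
            \<longleftrightarrow> (\<exists>q\<in>states M. \<forall>i<p. delta M q i = Some q))
       \<and> ((\<exists>q\<in>states M. \<forall>i<p. delta M q i = Some q)
            \<longleftrightarrow> (\<exists>w. set w \<subseteq> {..<p} \<and> {w \<frown> x | x. x \<in> digit_seqs p} \<subseteq> padic_language p K))"
proof -
  interpret path_presentation G p lab v0 by (rule assms(2))
  let ?L = "padic_language p K"
  have p: "p > 1" using assms(1) prime_gt_1_nat by blast
  have rec: "is_dfa p M" "dfa_language p M = ?L" "start M \<in> states M"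
    using assms(4) by (auto simp: minimal_dfa_def recognizes_def is_dfa_def)
  have L: "?L \<subseteq> digit_seqs p" by (auto simp: padic_language_def)
  \<comment> \<open>The dimension bounds concern images of sets of digit sequences, so
    \<open>K\<close> is written as the image of its language.\<close>
  have K: "K = padic_of_digits p ` ?L"
    unfolding assms(3) padic_language_path_set_fractal by (simp add: path_set_fractal_def)
  have loop_iff_cylinder: "(\<exists>q\<in>states M. \<forall>i<p. delta M q i = Some q)
      \<longleftrightarrow> (\<exists>w. set w \<subseteq> {..<p} \<and> {w \<frown> x | x. x \<in> digit_seqs p} \<subseteq> ?L)"
    using minimal_dfa_loop_iff_cylinder[OF assms(4)] p by simp
  have "hausdorff_dim (padic_int p) (padic_dist p) K = 1"
    if loop: "\<exists>q\<in>states M. \<forall>i<p. delta M q i = Some q"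
  proof (rule antisym)
    show "hausdorff_dim (padic_int p) (padic_dist p) K \<le> 1"
      using hausdorff_dim_padic_le_one[OF p L] K by simp
    obtain w where "set w \<subseteq> {..<p}" "{w \<frown> x | x. x \<in> digit_seqs p} \<subseteq> ?L"
      using loop loop_iff_cylinder by blast
    then show "1 \<le> hausdorff_dim (padic_int p) (padic_dist p) K"
      using p by (intro hausdorff_dim_cylinder_ge_one[of p w]) (auto simp: padic_language_def)
  qed
  \<comment> \<open>The other direction goes by contraposition: without a loop no state is
    universal, and the dimension drops strictly below 1.\<close>
  moreover have "hausdorff_dim (padic_int p) (padic_dist p) K < 1"
    if "\<not> (\<exists>q\<in>states M. \<forall>i<p. delta M q i = Some q)"
  proof -
    have "\<forall>q\<in>states M. \<not> universal_state p M q"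
      using that minimal_dfa_loop_iff_universal_state[OF assms(4)] by blast
    then obtain N where N: "\<And>q. q \<in> states M \<Longrightarrow> card (readable p M q N) \<le> p ^ N - 1" "N > 0"
      using uniformly_unreadable_word[OF _ rec(1)] p by auto
    have "card (prefix (k * N) ` ?L) \<le> (p ^ N - 1) ^ k" for k
    proof -
      have "prefix (k * N) c \<in> readable p M (start M) (k * N)" if "c \<in> ?L" for c
        using that set_prefix_digits[of c p "k * N"]
        unfolding rec(2)[symmetric] readable_def dfa_language_iff_run by simp
      then have "prefix (k * N) ` ?L \<subseteq> readable p M (start M) (k * N)" by blast
      then have "card (prefix (k * N) ` ?L) \<le> card (readable p M (start M) (k * N))"
        by (rule card_mono[OF finite_readable])
      also have "\<dots> \<le> (p ^ N - 1) ^ k" by (rule card_readable_le_power[OF rec(1) N(1) rec(3)])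
      finally show ?thesis .
    qed
    then show ?thesis using hausdorff_dim_padic_less_one[OF p N(2) L] K by simp
  qed
  ultimately have "hausdorff_dim (padic_int p) (padic_dist p) K = 1
      \<longleftrightarrow> (\<exists>q\<in>states M. \<forall>i<p. delta M q i = Some q)"
    by (metis less_irrefl)
  with loop_iff_cylinder show ?thesis by (rule conjI[rotated])
qed

end
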